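(* Let $m,n\geq1$ and let $\sigma,\mu\in\mathfrak{S}_n^{(m)}$. Then $$\mathcal{C}(\sigma\vee\mu)=\mathcal{C}(\sigma)\vee\mathcal{C}(\mu),$$ where on the left $\vee$ is the join in the $m$-permutations lattice and on the right $\vee$ is the join in the metasylvester lattice of metasylvester classes.
   Context: An $m$-permutation of size $n$ is a rearrangement of the word $1^m2^m\cdots n^m$; their set is $\mathfrak{S}_n^{(m)}$. For a letter $b$, $b_i$ denotes the $i$-th occurrence of $b$ from the left. A co-inversion of $\sigma\in\mathfrak{S}_n^{(m)}$ is a pair $(a_i,b_j)$ with $1\leq a<b\leq n$, $1\le i,j\le m$, such that $b_j$ appears before $a_i$ in $\sigma$; $\mathrm{coinv}(\sigma)$ is the set of co-inversions, and $\sigma\leq\mu$ means $\mathrm{coinv}(\sigma)\subseteq\mathrm{coinv}(\mu)$. This order is a lattice, the $m$-permutations lattice. The metasylvester congruence $\equiv$ on $\mathfrak{S}_n^{(m)}$ is the equivalence relation generated by $u\,ac\,v\,a\,w\equiv u\,ca\,v\,a\,w$ for letters $a<c$ and words $u,v,w$, and $u\,b\,v\,ac\,w\,b\,x\equiv u\,b\,v\,ca\,w\,b\,x$ for letters $a<b<c$ and words $u,v,w,x$. The class of $\sigma$ is denoted $\mathcal{C}(\sigma)$. Each class contains a unique maximal element for $\leq$, which is the only element of the class containing no subword (not necessarily consecutive) $a\cdots b\cdots a$ with $a<b$; the maximal element of $\mathcal{C}(\sigma)$ is $\mathrm{MaxClass}(\sigma)$. The metasylvester lattice is the set of metasylvester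 classes ordered by $\mathcal{C}(\sigma)\leq\mathcal{C}(\mu)$ if and only if $\mathrm{MaxClass}(\sigma)\leq\mathrm{MaxClass}(\mu)$ in the $m$-permutations lattice; this poset is a lattice. *)

theory Defs
  imports "HOL-Library.Multiset" "HOL-Algebra.Lattice"
begin

definition mperms :: "nat \<Rightarrow> nat \<Rightarrow> nat list set" where
  "mperms m n = {w. mset w = mset (concat (map (replicate m) [1..<Suc n]))}"

(* The i-th occurrence (i \<ge> 1, from the left) of the letter b in w is at position p;
   positions are counted from 0. *)
definition occurrence_at :: "nat list \<Rightarrow> nat \<Rightarrow> nat \<Rightarrow> nat \<Rightarrow> bool" where
  "occurrence_at w b i p \<longleftrightarrow>
     p < length w \<and> w ! p = b \<and> count_list (take (Suc p) w) b = i"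

(* The pair ((a, i), (b, j)) stands for (a_i, b_j). For w in mperms m n the bounds
   1 \<le> a < b \<le> n and 1 \<le> i, j \<le> m are enforced by occurrence_at. *)
definition coinv :: "nat list \<Rightarrow> ((nat \<times> nat) \<times> (nat \<times> nat)) set" where
  "coinv w = {((a, i), (b, j)) | a i b j.
     a < b \<and> (\<exists>p q. occurrence_at w b j p \<and> occurrence_at w a i q \<and> p < q)}"

definition mperm_lattice :: "nat \<Rightarrow> nat \<Rightarrow> nat list gorder" where
  "mperm_lattice m n =
     \<lparr> carrier = mperms m n, eq = (=), le = (\<lambda>\<sigma> \<mu>. coinv \<sigma> \<subseteq> coinv \<mu>) \<rparr>"

inductive metasylv_step :: "nat list \<Rightarrow> nat list \<Rightarrow> bool" where
  aca: "a < c \<Longrightarrow>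
    metasylv_step (u @ [a, c] @ v @ [a] @ w) (u @ [c, a] @ v @ [a] @ w)"
| bacb: "a < b \<Longrightarrow> b < c \<Longrightarrow>
    metasylv_step (u @ [b] @ v @ [a, c] @ w @ [b] @ x) (u @ [b] @ v @ [c, a] @ w @ [b] @ x)"

(* A step only swaps two letters, so restricting the generated equivalence to mperms m n
   agrees with generating it from the steps inside mperms m n. *)
definition metasylv_cong :: "nat \<Rightarrow> nat \<Rightarrow> (nat list \<times> nat list) set" where
  "metasylv_cong m n =
     {(\<sigma>, \<mu>). \<sigma> \<in> mperms m n \<and> \<mu> \<in> mperms m n \<and> equivclp metasylv_step \<sigma> \<mu>}"

definition metasylv_class :: "nat \<Rightarrow> nat \<Rightarrow> nat list \<Rightarrow> nat list set" where
  "metasylv_class m n \<sigma> = metasylv_cong m n `` {\<sigma>}"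

(* Meaningful when C has exactly one maximal element, as every metasylvester class does;
   class_max (metasylv_class m n \<sigma>) is then MaxClass(\<sigma>). *)
definition class_max :: "nat list set \<Rightarrow> nat list" where
  "class_max C = (THE \<tau>. \<tau> \<in> C \<and> (\<forall>\<rho>\<in>C. coinv \<tau> \<subseteq> coinv \<rho> \<longrightarrow> \<rho> = \<tau>))"

definition metasylv_lattice :: "nat \<Rightarrow> nat \<Rightarrow> nat list set gorder" where
  "metasylv_lattice m n =
     \<lparr> carrier = mperms m n // metasylv_cong m n, eq = (=),
       le = (\<lambda>C D. class_max C \<sqsubseteq>\<^bsub>mperm_lattice m n\<^esub> class_max D) \<rparr>"

end

theory Submission
  imports Defs "HOL-Library.Product_Lexorder"
begin

text \<open>Sending a word to the maximal element of its class is a closure operator whose closed elements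
  are the words avoiding \<open>a\<dots>b\<dots>a\<close> with \<open>a < b\<close>. Indeed, a metasylvester step increases the
  co-inversions, it is possible unless the word is closed, and it does not change which closed words
  lie above the word. Hence every class contains exactly one closed word, the least one above each of
  its members, and closure operators carry joins to joins of closed elements.

  The join of two words exists because the co-inversion sets are exactly the transitive sets of pairs
  of numbered letters that are also co-transitive for the lexicographic order (if \<open>x < y < z\<close> and
  \<open>(x, z)\<close> is in the set, then so is \<open>(x, y)\<close> or \<open>(y, z)\<close>): the transitive closure of the union of two
  such sets is again one.\<close>

section \<open>The order of the entries of a list\<close>

text \<open>The relation is on values rather than positions, so it is a strict linear order only for
  lists without repetitions; numbering the letters of a word will provide this.\<close>

fun before :: "'a list \<Rightarrow> 'a rel" where
  "before [] = {}"
| "before (x # xs) = {x} \<times> set xs \<union> before xs"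

lemma before_append [simp]:
  "before (xs @ ys) = before xs \<union> before ys \<union> set xs \<times> set ys"
  by (induction xs) auto

lemma before_subset: "(x, y) \<in> before xs \<Longrightarrow> x \<in> set xs \<and> y \<in> set xs"
  by (induction xs) auto

lemma before_iff_nth:
  "(x, y) \<in> before xs \<longleftrightarrow> (\<exists>p q. p < q \<and> q < length xs \<and> xs ! p = x \<and> xs ! q = y)"
proof (induction xs)
  case (Cons z zs)
  have "(\<exists>p q. p < q \<and> q < length (z # zs) \<and> (z # zs) ! p = x \<and> (z # zs) ! q = y) \<longleftrightarrow>
      (z = x \<and> y \<in> set zs) \<or> (\<exists>p q. p < q \<and> q < length zs \<and> zs ! p = x \<and> zs ! q = y)"
    (is "?L \<longleftrightarrow> ?R")
  proof
    assume ?L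
    then obtain p q where pq: "p < q" "q < length (z # zs)" "(z # zs) ! p = x" "(z # zs) ! q = y"
      by blast
    then obtain q' where "q = Suc q'"
      by (cases q) auto
    with pq show ?R
      by (cases p) auto
  next
    assume ?R
    then show ?L
    proof (elim disjE exE conjE)
      assume "z = x" "y \<in> set zs"
      then obtain q where "q < length zs" "zs ! q = y"
        by (auto simp: in_set_conv_nth)
      with \<open>z = x\<close> show ?L
        by (intro exI[of _ 0] exI[of _ "Suc q"]) auto
    next
      fix p q assume "p < q" "q < length zs" "zs ! p = x" "zs ! q = y"
      then show ?L
        by (intro exI[of _ "Suc p"] exI[of _ "Suc q"]) auto
    qed
  qed
  with Cons show ?case
    by auto
qed simp

lemma before_total:
  "x \<in> set xs \<Longrightarrow> y \<in> set xs \<Longrightarrow> x \<noteq> y \<Longrightarrow> (x, y) \<in> before xs \<or> (y, x) \<in> before xs"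
  by (induction xs) auto

lemma before_asym: "distinct xs \<Longrightarrow> (x, y) \<in> before xs \<Longrightarrow> (y, x) \<notin> before xs"
  by (induction xs) (auto dest: before_subset)

lemma before_irrefl: "distinct xs \<Longrightarrow> (x, x) \<notin> before xs"
  by (induction xs) auto

lemma before_trans:
  "distinct xs \<Longrightarrow> (x, y) \<in> before xs \<Longrightarrow> (y, z) \<in> before xs \<Longrightarrow> (x, z) \<in> before xs"
  by (induction xs) (auto dest: before_subset)

lemma before_split: "(x, y) \<in> before xs \<Longrightarrow> \<exists>us vs ws. xs = us @ x # vs @ y # ws"
proof (induction xs)
  case (Cons z zs)
  then show ?case
  proof (cases "(x, y) \<in> before zs")
    case True
    with Cons.IH show ?thesis
      by (metis append_Cons)
  next
    case False
    with Cons.prems have "x = z" "y \<in> set zs"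
      by auto
    then obtain vs ws where "zs = vs @ y # ws"
      by (meson split_list)
    with \<open>x = z\<close> show ?thesis
      by (metis append_Nil)
  qed
qed simp

text \<open>Different heads would each precede the other, against asymmetry. Once the heads agree,
  deleting the pairs that start with the head leaves the relation of the tail, and induction
  applies.\<close>

lemma before_inject:
  "distinct xs \<Longrightarrow> distinct ys \<Longrightarrow> set xs = set ys \<Longrightarrow> before xs = before ys \<Longrightarrow> xs = ys"
proof (induction xs arbitrary: ys)
  case Nil
  show ?case
    using Nil.prems(3) by simp
next
  case (Cons x xs)
  obtain y ys' where ys: "ys = y # ys'"
    using Cons.prems(3) by (cases ys) auto
  have "x = y"
  proof (rule ccontr)
    assume "x \<noteq> y"
    then have "y \<in> set xs" "x \<in> set ys'"
      using Cons.prems(3) ys by auto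
    then have "(x, y) \<in> before (x # xs)" "(y, x) \<in> before ys"
      using ys by simp_all
    then show False
      using before_asym[OF Cons.prems(2), of x y] Cons.prems(4) by blast
  qed
  have tail: "before zs = {p \<in> before (z # zs). fst p \<noteq> z}" if "distinct (z # zs)"
    for z and zs :: "'a list"
    using that by (auto dest: before_subset)
  have "set xs = set ys'"
    using Cons.prems(1-3) ys \<open>x = y\<close> by (simp add: insert_ident)
  moreover have "before xs = before ys'"
    using tail Cons.prems(1,2,4) ys \<open>x = y\<close> by metis
  ultimately have "xs = ys'"
    using Cons.IH[of ys'] Cons.prems(1,2) ys by simp
  then show ?case
    using ys \<open>x = y\<close> by simp
qed

text \<open>Sorting by the number of \<open>R\<close>-predecessors works because this rank strictly
  increases along \<open>R\<close>: an entry \<open>x\<close> standing before \<open>y\<close>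
  cannot satisfy \<open>R y x\<close>.\<close>

lemma before_sorting_exists:
  assumes "finite A"
    and total: "\<And>x y. x \<in> A \<Longrightarrow> y \<in> A \<Longrightarrow> x \<noteq> y \<Longrightarrow> R x y \<or> R y x"
    and irrefl: "\<And>x. x \<in> A \<Longrightarrow> \<not> R x x"
    and trans: "\<And>x y z. x \<in> A \<Longrightarrow> y \<in> A \<Longrightarrow> z \<in> A \<Longrightarrow> R x y \<Longrightarrow> R y z \<Longrightarrow> R x z"
  shows "\<exists>xs. distinct xs \<and> set xs = A \<and> (\<forall>x y. (x, y) \<in> before xs \<longrightarrow> R x y)"
proof -
  define rank where "rank x = card {y \<in> A. R y x}" for x
  have mono: "rank x < rank y" if "x \<in> A" "y \<in> A" "R x y" for x y
    unfolding rank_def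
  proof (rule psubset_card_mono)
    show "{z \<in> A. R z x} \<subset> {z \<in> A. R z y}"
      using that irrefl[of x] by (auto intro: trans)
  qed (use \<open>finite A\<close> in simp)
  obtain as where as: "set as = A" "distinct as"
    using finite_distinct_list[OF \<open>finite A\<close>] by blast
  define xs where "xs = sort_key rank as"
  have "set xs = A" "distinct xs"
    using as by (auto simp: xs_def)
  moreover have "R x y" if "(x, y) \<in> before xs" for x y
  proof -
    obtain p q where pq: "p < q" "q < length xs" "xs ! p = x" "xs ! q = y"
      using \<open>(x, y) \<in> before xs\<close> by (auto simp: before_iff_nth)
    have "sorted (map rank xs)"
      by (simp add: xs_def)
    then have "rank x \<le> rank y"
      using pq sorted_nth_mono[of "map rank xs" p q] by simp
    moreover have "x \<in> A" "y \<in> A"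
      using before_subset[OF that] \<open>set xs = A\<close> by auto
    moreover have "x \<noteq> y"
      using that before_irrefl[OF \<open>distinct xs\<close>, of x] by auto
    ultimately show ?thesis
      using total[of x y] mono[of y x] by auto
  qed
  ultimately show ?thesis
    by blast
qed

section \<open>Words with numbered occurrences\<close>

text \<open>The accumulator \<open>f\<close> counts the copies of each letter read so far. It is a
  parameter so that the numbering of a suffix can start from the counts left by its prefix.\<close>

fun number_from :: "('a \<Rightarrow> nat) \<Rightarrow> 'a list \<Rightarrow> ('a \<times> nat) list" where
  "number_from f [] = []"
| "number_from f (x # xs) = (x, Suc (f x)) # number_from (f(x := Suc (f x))) xs"

abbreviation numbered :: "'a list \<Rightarrow> ('a \<times> nat) list" where
  "numbered \<equiv> number_from (\<lambda>_. 0)"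

definition occurrences :: "'a multiset \<Rightarrow> ('a \<times> nat) set" where
  "occurrences M = {(b, i). 1 \<le> i \<and> i \<le> count M b}"

lemma number_from_append:
  "number_from f (u @ v) = number_from f u @ number_from (\<lambda>x. f x + count_list u x) v"
  by (induction u arbitrary: f) (auto intro!: arg_cong[of _ _ "\<lambda>g. number_from g v"])

lemma map_fst_number_from [simp]: "map fst (number_from f w) = w"
  by (induction w arbitrary: f) auto

lemma length_number_from [simp]: "length (number_from f w) = length w"
  by (induction w arbitrary: f) auto

lemma nth_number_from:
  "p < length w \<Longrightarrow> number_from f w ! p = (w ! p, f (w ! p) + count_list (take (Suc p) w) (w ! p))"
proof (induction w arbitrary: f p)
  case (Cons x w)
  then show ?case
    by (cases p) auto
qed simp

lemma occurrence_at_iff: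
  "occurrence_at w b i p \<longleftrightarrow> p < length w \<and> numbered w ! p = (b, i)"
  by (auto simp: occurrence_at_def nth_number_from)

lemma set_numbered: "set (numbered w) = occurrences (mset w)"
proof (induction w rule: rev_induct)
  case (snoc a w)
  then show ?case
    by (auto simp: number_from_append occurrences_def simp flip: count_mset split: if_splits)
qed (simp add: occurrences_def)

lemma finite_occurrences: "finite (occurrences M)"
proof -
  obtain w where "mset w = M"
    using ex_mset by blast
  then show ?thesis
    using set_numbered[of w] by (metis List.finite_set)
qed

lemma occurrences_inject:
  assumes "occurrences M = occurrences N"
  shows "M = N"
proof (rule multiset_eqI)
  fix b
  have "{1..count M b} = {1..count N b}"
    using assms by (auto simp: occurrences_def set_eq_iff)
  then show "count M b = count N b"
    by (metis card_atLeastAtMost diff_Suc_1)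
qed

lemma distinct_numbered: "distinct (numbered w)"
  by (induction w rule: rev_induct)
    (auto simp: number_from_append set_numbered occurrences_def count_mset)

lemma before_numbered_same_letter:
  "((a, i), (a, j)) \<in> before (numbered w) \<Longrightarrow> i < j"
  by (induction w rule: rev_induct)
    (auto simp: number_from_append set_numbered occurrences_def count_mset)

text \<open>Induction from the right: the earlier copies of the last letter \<open>a\<close> carry
  the numbers 1 to \<open>?c\<close>, and its own number \<open>i\<close> is not among them while
  \<open>i - 1\<close> is, unless \<open>i = 1\<close>; so \<open>i\<close> is the number that
  \<open>numbered\<close> assigns.\<close>

lemma numbered_map_fst:
  assumes "distinct xs"
    and "\<And>a i. (a, i) \<in> set xs \<Longrightarrow> 1 \<le> i"
    and "\<And>a i k. (a, i) \<in> set xs \<Longrightarrow> 1 \<le> k \<Longrightarrow> k \<le> i \<Longrightarrow> (a, k) \<in> set xs"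
    and "\<And>a i j. ((a, i), (a, j)) \<in> before xs \<Longrightarrow> i < j"
  shows "numbered (map fst xs) = xs"
  using assms
proof (induction xs rule: rev_induct)
  case (snoc x xs)
  obtain a i where x: "x = (a, i)"
    by fastforce
  \<comment> \<open>Removing the last entry leaves the numbers downward closed, since all other
    copies of \<open>a\<close> precede it and so have smaller numbers.\<close>
  have down: "(b, k) \<in> set xs" if "(b, j) \<in> set xs" "1 \<le> k" "k \<le> j" for b j k
  proof -
    have "(b, k) \<noteq> (a, i)"
      using snoc.prems(4)[of a j i] snoc.prems(1) that x by auto
    then show ?thesis
      using snoc.prems(3)[of b j k] that x by auto
  qed
  have IH: "numbered (map fst xs) = xs"
  proof (rule snoc.IH)
    show "distinct xs"
      using snoc.prems(1) by simp
    show "1 \<le> i" if "(a, i) \<in> set xs" for a i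
      using that snoc.prems(2)[of a i] by simp
    show "i < j" if "((a, i), (a, j)) \<in> before xs" for a i j
      using that snoc.prems(4)[of a i j] by simp
  qed (fact down)
  let ?c = "count_list (map fst xs) a"
  have "set xs = occurrences (mset (map fst xs))"
    using set_numbered[of "map fst xs"] unfolding IH .
  then have set_xs: "(a, k) \<in> set xs \<longleftrightarrow> 1 \<le> k \<and> k \<le> ?c" for k
    unfolding occurrences_def count_mset by blast
  have "1 \<le> i"
    using snoc.prems(2)[of a i] x by simp
  moreover have "(a, i) \<notin> set xs"
    using snoc.prems(1) x by simp
  moreover have "(a, i - 1) \<in> set xs" if "i > 1"
  proof -
    have "(a, i - 1) \<in> set (xs @ [x])"
      using snoc.prems(3)[of a i "i - 1"] x that by simp
    then show ?thesis
      using x that by auto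
  qed
  ultimately have "i = Suc ?c"
    unfolding set_xs by linarith
  then show ?case
    using IH x by (simp add: number_from_append)
qed simp

section \<open>Co-inversion sets\<close>

text \<open>Replaces positions by the order of numbered letters. The pair has its smaller letter
  first, whereas the word has its larger letter first.\<close>

lemma coinv_iff:
  "(x, y) \<in> coinv w \<longleftrightarrow> fst x < fst y \<and> (y, x) \<in> before (numbered w)"
  by (cases x; cases y)
    (simp add: coinv_def occurrence_at_iff before_iff_nth, metis order.strict_trans)

lemma coinv_subset: "coinv w \<subseteq> occurrences (mset w) \<times> occurrences (mset w)"
  by (auto simp: coinv_iff dest!: before_subset simp: set_numbered)

text \<open>Co-inversions determine the whole order: numbered letters stand in lexicographic order
  except for the pairs that are reversed. Copies of one letter are never reversed.\<close>

lemma before_numbered_iff: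
  assumes "x \<in> occurrences (mset w)" "y \<in> occurrences (mset w)"
  shows "(x, y) \<in> before (numbered w) \<longleftrightarrow> (x < y \<and> (x, y) \<notin> coinv w) \<or> (y, x) \<in> coinv w"
proof -
  have xy: "x \<in> set (numbered w)" "y \<in> set (numbered w)"
    using assms by (simp_all add: set_numbered)
  obtain a i b j where [simp]: "x = (a, i)" "y = (b, j)"
    by fastforce
  show ?thesis
    using before_total[OF xy] before_asym[OF distinct_numbered[of w], of x y]
      before_irrefl[OF distinct_numbered[of w], of x]
      before_numbered_same_letter[of a i j w] before_numbered_same_letter[of a j i w]
    by (cases a b rule: linorder_cases) (auto simp: coinv_iff)
qed

text \<open>This is antisymmetry of the order on words. The co-inversions give back the order of the
  numbered letters, hence the numbered word, hence the word.\<close>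

lemma coinv_inject:
  assumes "mset v = mset w" "coinv v = coinv w"
  shows "v = w"
proof -
  have "before (numbered v) = before (numbered w)"
  proof (rule Set.set_eqI)
    fix z :: "(nat \<times> nat) \<times> (nat \<times> nat)"
    obtain x y where z: "z = (x, y)"
      by (cases z)
    show "z \<in> before (numbered v) \<longleftrightarrow> z \<in> before (numbered w)"
    proof (cases "x \<in> occurrences (mset v) \<and> y \<in> occurrences (mset v)")
      case True
      with assms z show ?thesis
        by (simp add: before_numbered_iff)
    next
      case False
      with assms z show ?thesis
        using before_subset[of x y "numbered v"] before_subset[of x y "numbered w"]
        by (auto simp: set_numbered)
    qed
  qed
  then have "numbered v = numbered w"
    using assms by (intro before_inject) (simp_all add: distinct_numbered set_numbered)
  then show ?thesis
    by (metis map_fst_number_from)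
qed

lemma trans_coinv: "trans (coinv w)"
proof (rule transI)
  fix x y z
  assume "(x, y) \<in> coinv w" "(y, z) \<in> coinv w"
  then show "(x, z) \<in> coinv w"
    using before_trans[OF distinct_numbered, of z y w x] by (auto simp: coinv_iff)
qed

text \<open>If neither pair were reversed, \<open>x\<close> would stand before \<open>y\<close> and
  \<open>y\<close> before \<open>z\<close>, although \<open>z\<close> stands before
  \<open>x\<close>.\<close>

lemma coinv_cotrans:
  assumes "(x, z) \<in> coinv w" "x < y" "y < z" "y \<in> occurrences (mset w)"
  shows "(x, y) \<in> coinv w \<or> (y, z) \<in> coinv w"
proof (rule ccontr)
  assume "\<not> ?thesis"
  moreover have "x \<in> occurrences (mset w)" "z \<in> occurrences (mset w)"
    using assms(1) coinv_subset by auto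
  ultimately have "(x, y) \<in> before (numbered w)" "(y, z) \<in> before (numbered w)"
    using assms by (simp_all add: before_numbered_iff)
  moreover have "(z, x) \<in> before (numbered w)"
    using assms(1) by (simp add: coinv_iff)
  ultimately show False
    using before_trans[OF distinct_numbered, of x y w z] before_asym[OF distinct_numbered, of x z w]
    by blast
qed

text \<open>Reversing the pairs of \<open>T\<close> in the lexicographic order gives a strict linear
  order \<open>R\<close>; listing the numbered letters along \<open>R\<close> and forgetting the
  numbers yields the word.\<close>

lemma coinv_realization:
  assumes sub: "T \<subseteq> occurrences M \<times> occurrences M"
    and "trans T"
    and letter: "\<And>x y. (x, y) \<in> T \<Longrightarrow> fst x < fst y"
    and cotrans: "\<And>x y z. (x, z) \<in> T \<Longrightarrow> x < y \<Longrightarrow> y < z \<Longrightarrow> y \<in> occurrences M \<Longrightarrow>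
      (x, y) \<in> T \<or> (y, z) \<in> T"
  shows "\<exists>w. mset w = M \<and> coinv w = T"
proof -
  define R where "R x y \<longleftrightarrow> (x < y \<and> (x, y) \<notin> T) \<or> (y, x) \<in> T" for x y
  have less: "x < y" if "(x, y) \<in> T" for x y
    using letter[OF that] by (cases x; cases y) simp
  have trans: "(x, z) \<in> T" if "(x, y) \<in> T" "(y, z) \<in> T" for x y z
    using that \<open>trans T\<close> by (meson transE)
  have "\<exists>xs. distinct xs \<and> set xs = occurrences M \<and> (\<forall>x y. (x, y) \<in> before xs \<longrightarrow> R x y)"
  proof (rule before_sorting_exists[OF finite_occurrences])
    show "R x y \<or> R y x" if "x \<noteq> y" for x y
      using that unfolding R_def by (cases x y rule: linorder_cases) auto
    show "\<not> R x x" for x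
      using less[of x x] unfolding R_def by auto
    fix x y z
    assume xyz: "x \<in> occurrences M" "y \<in> occurrences M" "z \<in> occurrences M"
      and "R x y" "R y z"
    from \<open>R x y\<close> consider "x < y" "(x, y) \<notin> T" | "(y, x) \<in> T"
      unfolding R_def by blast
    \<comment> \<open>Two unreversed pairs compose by co-transitivity and two reversed ones by
      transitivity. In the mixed cases \<open>x\<close> and \<open>z\<close> lie on the same side of
      \<open>y\<close>: transitivity settles \<open>x < z\<close> and co-transitivity settles
      \<open>z < x\<close>.\<close>
    then show "R x z"
    proof cases
      case 1
      from \<open>R y z\<close> consider "y < z" "(y, z) \<notin> T" | "(z, y) \<in> T"
        unfolding R_def by blast
      then show ?thesis
      proof cases
        case 1
        then show ?thesis
          using cotrans[of x z y] \<open>x < y\<close> \<open>(x, y) \<notin> T\<close> xyz unfolding R_def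
          by (meson order.strict_trans)
      next
        case 2
        then show ?thesis
          using cotrans[of z y x] trans[of x z y] \<open>x < y\<close> \<open>(x, y) \<notin> T\<close> xyz
          unfolding R_def by (cases x z rule: linorder_cases) auto
      qed
    next
      case 2
      from \<open>R y z\<close> consider "y < z" "(y, z) \<notin> T" | "(z, y) \<in> T"
        unfolding R_def by blast
      then show ?thesis
      proof cases
        case 1
        then show ?thesis
          using cotrans[of y x z] trans[of y x z] \<open>(y, x) \<in> T\<close> xyz
          unfolding R_def by (cases x z rule: linorder_cases) auto
      next
        case 2
        then show ?thesis
          using trans[of z y x] \<open>(y, x) \<in> T\<close> unfolding R_def by blast
      qed
    qed
  qed
  then obtain xs where xs: "distinct xs" "set xs = occurrences M"
    and bef: "\<And>x y. (x, y) \<in> before xs \<Longrightarrow> R x y"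
    by blast
  have num: "numbered (map fst xs) = xs"
  proof (rule numbered_map_fst[OF xs(1)])
    \<comment> \<open>\<open>T\<close> relates only different letters, so copies of one letter keep
      their order.\<close>
    show "i < j" if "((a, i), (a, j)) \<in> before xs" for a i j
      using bef[OF that] letter[of "(a, j)" "(a, i)"] unfolding R_def by auto
  qed (auto simp: xs occurrences_def)
  have "mset (map fst xs) = M"
    using set_numbered[of "map fst xs"] unfolding num xs by (metis occurrences_inject)
  moreover have "coinv (map fst xs) = T"
  proof -
    have "(x, y) \<in> T" if "fst x < fst y" "(y, x) \<in> before xs" for x y
      using bef[OF that(2)] that(1) less_asym unfolding R_def by (cases x; cases y) auto
    moreover have "(y, x) \<in> before xs" if "(x, y) \<in> T" for x y
    proof -
      have "x < y" "x \<in> set xs" "y \<in> set xs"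
        using less sub xs that by auto
      moreover have "\<not> R x y"
        using less that unfolding R_def by (meson less_asym)
      ultimately show ?thesis
        using before_total[of x xs y] bef by blast
    qed
    ultimately have "(x, y) \<in> coinv (map fst xs) \<longleftrightarrow> (x, y) \<in> T" for x y
      unfolding coinv_iff num using letter[of x y] by blast
    then show ?thesis
      by auto
  qed
  ultimately show ?thesis
    by blast
qed

lemma coinv_join_exists:
  assumes "mset v = mset w"
  shows "\<exists>u. mset u = mset w \<and> coinv u = (coinv v \<union> coinv w)\<^sup>+"
proof (rule coinv_realization)
  let ?A = "coinv v \<union> coinv w"
  show "?A\<^sup>+ \<subseteq> occurrences (mset w) \<times> occurrences (mset w)"
    using coinv_subset[of v] coinv_subset[of w] assms by (intro trancl_subset_Sigma) auto
  show "trans (?A\<^sup>+)"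
    by (rule trans_trancl)
  show "fst x < fst y" if "(x, y) \<in> ?A\<^sup>+" for x y
    using that by (induction rule: trancl_induct) (auto simp: coinv_iff)
  show "(x, y) \<in> ?A\<^sup>+ \<or> (y, z) \<in> ?A\<^sup>+"
    if "(x, z) \<in> ?A\<^sup>+" "x < y" "y < z" "y \<in> occurrences (mset w)" for x y z
    using that
  proof (induction rule: trancl_induct)
    case (base z)
    then show ?case
      using coinv_cotrans[of x z v y] coinv_cotrans[of x z w y] assms by auto
  next
    case (step z z')
    \<comment> \<open>Here \<open>(z, z')\<close> is the last link of the chain. If \<open>y\<close>
      lies below \<open>z\<close>, the shorter chain is split; if above, the link itself is split,
      and its lower half can be appended to the chain from \<open>x\<close> to
      \<open>z\<close>.\<close>
    consider "y < z" | "y = z" | "z < y"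
      by (rule linorder_cases)
    then show ?case
    proof cases
      case 1
      then show ?thesis
        using step by (meson trancl.trancl_into_trancl)
    next
      case 2
      then show ?thesis
        using step by blast
    next
      case 3
      then have "(z, y) \<in> ?A \<or> (y, z') \<in> ?A"
        using coinv_cotrans[of z z' v y] coinv_cotrans[of z z' w y] step assms by auto
      then show ?thesis
        using step by (meson r_into_trancl trancl.trancl_into_trancl)
    qed
  qed
qed

section \<open>Metasylvester classes\<close>

definition avoids_aba :: "nat list \<Rightarrow> bool" where
  "avoids_aba w \<longleftrightarrow> \<not> (\<exists>a b u v x. a < b \<and> w = u @ a # v @ b # x \<and> a \<in> set x)"

text \<open>As numbered letters are distinct, a copy of \<open>a\<close> after \<open>(b, j)\<close>
  must lie in the suffix behind it, and forgetting numbers exposes a forbidden subword.\<close>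

lemma avoids_aba_before:
  assumes "avoids_aba w" "a < b" "((a, i), (b, j)) \<in> before (numbered w)"
  shows "((b, j), (a, k)) \<notin> before (numbered w)"
proof
  assume ba: "((b, j), (a, k)) \<in> before (numbered w)"
  obtain us vs xs where num: "numbered w = us @ (a, i) # vs @ (b, j) # xs"
    using before_split[OF assms(3)] by blast
  then have "distinct (us @ (a, i) # vs @ (b, j) # xs)"
    using distinct_numbered by metis
  then have "(a, k) \<in> set xs"
    using ba unfolding num by (auto dest: before_subset)
  then have "a \<in> set (map fst xs)"
    by force
  moreover have "w = map fst us @ a # map fst vs @ b # map fst xs"
    using arg_cong[OF num, of "map fst"] by simp
  ultimately show False
    using assms(1,2) unfolding avoids_aba_def by blast
qed

text \<open>In a shortest factor \<open>a v c\<close> with \<open>a < c\<close> and a later \<open>a\<close>, all letters of \<open>v\<close> are smaller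
  than \<open>a\<close>, so either \<open>v\<close> is empty or its last letter can be exchanged with \<open>c\<close>.\<close>

lemma metasylv_step_exists:
  assumes "\<not> avoids_aba w"
  shows "\<exists>w'. metasylv_step w w'"
proof -
  define P where "P k \<longleftrightarrow> (\<exists>a c u v x. a < c \<and> w = u @ a # v @ c # x \<and> a \<in> set x \<and> length v = k)" for k
  have "\<exists>k. P k"
    using assms unfolding avoids_aba_def P_def by blast
  then obtain k where k: "P k" "\<And>l. l < k \<Longrightarrow> \<not> P l"
    by (metis LeastI_ex not_less_Least)
  then obtain a c u v x where w: "a < c" "w = u @ a # v @ c # x" "a \<in> set x" "length v = k"
    unfolding P_def by blast
  have small: "y < a" if "y \<in> set v" for y
  proof (rule ccontr)
    assume "\<not> y < a"
    obtain v1 v2 where v: "v = v1 @ y # v2"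
      using split_list[OF \<open>y \<in> set v\<close>] by blast
    \<comment> \<open>A letter of \<open>v\<close> equal to \<open>a\<close> could replace the
      initial \<open>a\<close>, and a larger one could replace \<open>c\<close>; both give a shorter
      factor.\<close>
    show False
    proof (cases "y = a")
      case True
      have "P (length v2)"
        unfolding P_def using w v True
        by (intro exI[of _ a] exI[of _ c] exI[of _ "u @ a # v1"] exI[of _ v2] exI[of _ x]) auto
      then show False
        using k(2) v w(4) by auto
    next
      case False
      then have "P (length v1)"
        unfolding P_def using w v \<open>\<not> y < a\<close>
        by (intro exI[of _ a] exI[of _ y] exI[of _ u] exI[of _ v1] exI[of _ "v2 @ c # x"]) auto
      then show False
        using k(2) v w(4) by auto
    qed
  qed
  obtain x1 x2 where x: "x = x1 @ a # x2"
    using split_list[OF w(3)] by blast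
  show ?thesis
  proof (cases v rule: rev_cases)
    case Nil
    then show ?thesis
      using aca[OF w(1), of u x1 x2] w(2) x by auto
  next
    case (snoc v' y)
    \<comment> \<open>Here \<open>a\<close> is the middle letter of the rule: its copies in front of
      \<open>v\<close> and in \<open>x\<close> enclose the adjacent letters \<open>y\<close> and
      \<open>c\<close>, with \<open>y < a < c\<close>.\<close>
    then show ?thesis
      using bacb[OF small w(1), of y u v' x1 x2] w(2) x by auto
  qed
qed

text \<open>Brings both rules to one form: two adjacent numbered letters are exchanged, and the
  context contains the copies that license the exchange.\<close>

lemma metasylv_step_swap:
  assumes "metasylv_step w w'"
  shows "\<exists>X a i c j Y. a < c
    \<and> numbered w = X @ [(a, i), (c, j)] @ Y \<and> numbered w' = X @ [(c, j), (a, i)] @ Y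
    \<and> (a \<in> fst ` set Y \<or> (\<exists>b. a < b \<and> b < c \<and> b \<in> fst ` set X \<and> b \<in> fst ` set Y))"
proof -
  have swap: ?thesis
    if "a < c" "w = u @ [a, c] @ v" "w' = u @ [c, a] @ v"
      "a \<in> set v \<or> (\<exists>b. a < b \<and> b < c \<and> b \<in> set u \<and> b \<in> set v)" for a c u v
  proof -
    define f where "f = (\<lambda>x. count_list u x)"
    \<comment> \<open>Since \<open>a\<close> and \<open>c\<close> differ, the counters after reading
      them do not depend on their order, so the numbered suffix is the same for both words.\<close>
    define Y where "Y = number_from (f(a := Suc (f a), c := Suc (f c))) v"
    have "numbered w = numbered u @ [(a, Suc (f a)), (c, Suc (f c))] @ Y"
      "numbered w' = numbered u @ [(c, Suc (f c)), (a, Suc (f a))] @ Y"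
      using that(1) fun_upd_twist[of a c f] unfolding that f_def Y_def
      by (simp_all add: number_from_append)
    moreover have "fst ` set (number_from g z) = set z" for g and z :: "nat list"
      by (metis list.set_map map_fst_number_from)
    ultimately show ?thesis
      using that(1,4) unfolding Y_def by metis
  qed
  show ?thesis
    using assms
  proof cases
    case (aca a c u v x)
    then show ?thesis
      by (intro swap[of a c u "v @ [a] @ x"]) auto
  next
    case (bacb a b c u v x y)
    then show ?thesis
      by (intro swap[of a c "u @ [b] @ v" "x @ [b] @ y"]) auto
  qed
qed

lemma metasylv_step_mset: "metasylv_step w w' \<Longrightarrow> mset w' = mset w"
  by (induction rule: metasylv_step.induct) auto

lemma metasylv_step_coinv_psubset:
  assumes "metasylv_step w w'"
  shows "coinv w \<subset> coinv w'"
proof -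
  obtain X a i c j Y where *: "a < c" "numbered w = X @ [(a, i), (c, j)] @ Y" "numbered w' = X @ [(c, j), (a, i)] @ Y"
    using metasylv_step_swap[OF assms] by blast
  then have "((a, i), (c, j)) \<in> coinv w'"
    by (simp add: coinv_iff)
  moreover have "((a, i), (c, j)) \<notin> coinv w"
    using before_asym[OF distinct_numbered[of w], of "(a, i)" "(c, j)"] * by (simp add: coinv_iff)
  moreover have "coinv w \<subseteq> coinv w'"
    using * by (auto simp: coinv_iff)
  ultimately show ?thesis
    by blast
qed

text \<open>The step adds only the co-inversion of the exchanged letters. A closed word above
  \<open>w\<close> already has it, because the context letters would otherwise create a forbidden
  subword.\<close>

lemma metasylv_step_coinv_le_iff:
  assumes step: "metasylv_step w w'" and "mset t = mset w" "avoids_aba t"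
  shows "coinv w \<subseteq> coinv t \<longleftrightarrow> coinv w' \<subseteq> coinv t"
proof
  assume le: "coinv w \<subseteq> coinv t"
  obtain X a i c j Y where ac: "a < c"
    and num: "numbered w = X @ [(a, i), (c, j)] @ Y" "numbered w' = X @ [(c, j), (a, i)] @ Y"
    and ex: "a \<in> fst ` set Y \<or> (\<exists>b. a < b \<and> b < c \<and> b \<in> fst ` set X \<and> b \<in> fst ` set Y)"
    using metasylv_step_swap[OF step] by blast
  have before_t: "(y, x) \<in> before (numbered t)" if "fst x < fst y" "(y, x) \<in> before (numbered w)" for x y
    using subsetD[OF le, of "(x, y)"] that by (simp add: coinv_iff)
  have "((c, j), (a, i)) \<in> before (numbered t)"
  proof (rule ccontr)
    assume "\<not> ?thesis"
    moreover have "(a, i) \<in> set (numbered t)" "(c, j) \<in> set (numbered t)"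
      using \<open>mset t = mset w\<close> num(1) set_numbered[of w] set_numbered[of t] by auto
    ultimately have ac_t: "((a, i), (c, j)) \<in> before (numbered t)"
      using before_total[of "(a, i)" "numbered t" "(c, j)"] ac by auto
    from ex show False
    proof (elim disjE exE conjE)
      \<comment> \<open>The later copy of \<open>a\<close> stands after \<open>c\<close> in
        \<open>t\<close> as well, so \<open>t\<close> would contain \<open>a c a\<close>.\<close>
      assume "a \<in> fst ` set Y"
      then obtain k where "(a, k) \<in> set Y"
        by auto
      then show False
        using avoids_aba_before[OF \<open>avoids_aba t\<close> ac ac_t, of k] before_t[of "(a, k)" "(c, j)"] ac num(1)
        by auto
    next
      \<comment> \<open>Co-inversions of \<open>w\<close> put one copy of \<open>b\<close> before
        \<open>a\<close> and another after \<open>c\<close> in \<open>t\<close>, so \<open>t\<close>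
        would contain \<open>b c b\<close>.\<close>
      fix b assume b: "a < b" "b < c" "b \<in> fst ` set X" "b \<in> fst ` set Y"
      then obtain k l where "(b, k) \<in> set X" "(b, l) \<in> set Y"
        by auto
      then have "((b, k), (a, i)) \<in> before (numbered t)" "((c, j), (b, l)) \<in> before (numbered t)"
        using before_t[of "(a, i)" "(b, k)"] before_t[of "(b, l)" "(c, j)"] b num(1) by auto
      then show False
        using avoids_aba_before[OF \<open>avoids_aba t\<close> \<open>b < c\<close>, of k j l] ac_t
          before_trans[OF distinct_numbered[of t], of "(b, k)" "(a, i)" "(c, j)"] by blast
    qed
  qed
  moreover have "coinv w' = insert ((a, i), (c, j)) (coinv w)"
    using ac by (auto simp: coinv_iff num)
  ultimately show "coinv w' \<subseteq> coinv t"
    using le ac by (simp add: coinv_iff)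
qed (use metasylv_step_coinv_psubset[OF step] in blast)

section \<open>Invariants of the congruence and closed representatives\<close>

lemma equivclp_invariant:
  assumes "equivclp R x y" "\<And>x y. R x y \<Longrightarrow> P x = P y"
  shows "P x = P y"
  using assms(1) by (induction rule: equivclp_induct) (auto dest: assms(2))

lemma metasylv_equiv_mset: "equivclp metasylv_step w w' \<Longrightarrow> mset w' = mset w"
  using equivclp_invariant[of metasylv_step w w' mset] metasylv_step_mset by metis

lemma metasylv_equiv_coinv_le_iff:
  assumes "equivclp metasylv_step w w'" "mset t = mset w" "avoids_aba t"
  shows "coinv w \<subseteq> coinv t \<longleftrightarrow> coinv w' \<subseteq> coinv t"
proof -
  \<comment> \<open>The multiset equation is part of the invariant because the result on single
    steps assumes it.\<close>
  have "(mset t = mset w \<and> coinv w \<subseteq> coinv t) = (mset t = mset w' \<and> coinv w' \<subseteq> coinv t)"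
    using assms(1)
  proof (rule equivclp_invariant)
    show "(mset t = mset x \<and> coinv x \<subseteq> coinv t) = (mset t = mset y \<and> coinv y \<subseteq> coinv t)"
      if "metasylv_step x y" for x y
      using metasylv_step_coinv_le_iff[OF that _ assms(3)] metasylv_step_mset[OF that] by auto
  qed
  then show ?thesis
    using assms(1,2) metasylv_equiv_mset by auto
qed

text \<open>Applying steps terminates: each one strictly enlarges the co-inversion set inside a
  fixed finite set of pairs.\<close>

lemma avoids_aba_representative:
  "\<exists>t. equivclp metasylv_step w t \<and> avoids_aba t"
proof (induction "card (occurrences (mset w) \<times> occurrences (mset w) - coinv w)"
    arbitrary: w rule: less_induct)
  case less
  show ?case
  proof (cases "avoids_aba w")
    case False
    then obtain w' where step: "metasylv_step w w'"
      using metasylv_step_exists by blast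
    have "card (occurrences (mset w') \<times> occurrences (mset w') - coinv w')
        < card (occurrences (mset w) \<times> occurrences (mset w) - coinv w)"
      using metasylv_step_coinv_psubset[OF step] coinv_subset[of w']
        metasylv_step_mset[OF step] finite_occurrences[of "mset w"]
      by (intro psubset_card_mono) auto
    then obtain t where "equivclp metasylv_step w' t" "avoids_aba t"
      using less by blast
    then show ?thesis
      using step by (meson equivclp_trans r_into_equivclp)
  qed (meson equivclp_refl)
qed

text \<open>The choice is harmless: two closed members of a class have the same closed words above
  them, so each lies below the other and they coincide.\<close>

definition max_class :: "nat list \<Rightarrow> nat list" where
  "max_class w = (SOME t. equivclp metasylv_step w t \<and> avoids_aba t)"

lemma equivclp_max_class: "equivclp metasylv_step w (max_class w)"
  and avoids_aba_max_class: "avoids_aba (max_class w)"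
  unfolding max_class_def using someI_ex[OF avoids_aba_representative[of w]] by auto

lemma mset_max_class: "mset (max_class w) = mset w"
  by (rule metasylv_equiv_mset[OF equivclp_max_class])

text \<open>The closure property: \<open>max_class w\<close> is the least closed word above
  \<open>w\<close>.\<close>

lemma max_class_le_iff:
  assumes "mset t = mset w" "avoids_aba t"
  shows "coinv (max_class w) \<subseteq> coinv t \<longleftrightarrow> coinv w \<subseteq> coinv t"
  using metasylv_equiv_coinv_le_iff[OF equivclp_max_class assms] by simp

lemma coinv_le_max_class: "coinv w \<subseteq> coinv (max_class w)"
  using max_class_le_iff[OF mset_max_class avoids_aba_max_class] by simp

text \<open>Each of the two closed words lies above both \<open>w\<close> and \<open>w'\<close>,
  hence above the other one by leastness.\<close>

lemma max_class_cong:
  assumes "equivclp metasylv_step w w'"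
  shows "max_class w = max_class w'"
proof (rule coinv_inject)
  have eq: "mset w' = mset w"
    by (rule metasylv_equiv_mset[OF assms])
  then show "mset (max_class w) = mset (max_class w')"
    by (simp add: mset_max_class)
  show "coinv (max_class w) = coinv (max_class w')"
    using metasylv_equiv_coinv_le_iff[OF assms, of "max_class w"]
      metasylv_equiv_coinv_le_iff[OF assms, of "max_class w'"]
      max_class_le_iff[of "max_class w'" w] max_class_le_iff[of "max_class w" w']
    by (simp add: eq mset_max_class avoids_aba_max_class coinv_le_max_class)
qed

section \<open>Classes of m-permutations and their maximal elements\<close>

lemma mperms_mset_eq: "v \<in> mperms m n \<Longrightarrow> w \<in> mperms m n \<Longrightarrow> mset v = mset w"
  by (simp add: mperms_def)

lemma mperms_mset_cong: "mset v = mset w \<Longrightarrow> v \<in> mperms m n \<longleftrightarrow> w \<in> mperms m n"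
  by (simp add: mperms_def)

lemma mem_metasylv_class:
  "w \<in> mperms m n \<Longrightarrow> v \<in> metasylv_class m n w \<longleftrightarrow> equivclp metasylv_step w v"
  using mperms_mset_cong[OF metasylv_equiv_mset]
  by (auto simp: metasylv_class_def metasylv_cong_def)

lemma metasylv_class_eqI:
  assumes "v \<in> mperms m n" "w \<in> mperms m n" "max_class v = max_class w"
  shows "metasylv_class m n v = metasylv_class m n w"
proof -
  have "equivclp metasylv_step v w"
    using equivclp_max_class[of v] equivclp_max_class[of w] assms(3)
    by (metis equivclp_sym equivclp_trans)
  then show ?thesis
    using assms(1,2) unfolding set_eq_iff by (metis mem_metasylv_class equivclp_trans equivclp_sym)
qed

text \<open>All members of the class share the same \<open>max_class\<close> and lie below it, so it
  is the greatest and hence the only maximal member.\<close>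

lemma class_max_metasylv_class:
  assumes "w \<in> mperms m n"
  shows "class_max (metasylv_class m n w) = max_class w"
  unfolding class_max_def
proof (rule the_equality)
  have le: "coinv v \<subseteq> coinv (max_class w)" if "v \<in> metasylv_class m n w" for v
    using that assms coinv_le_max_class[of v] max_class_cong by (metis mem_metasylv_class)
  have mem: "max_class w \<in> metasylv_class m n w"
    using assms equivclp_max_class by (simp add: mem_metasylv_class)
  have "v = max_class w" if "v \<in> metasylv_class m n w" "coinv (max_class w) \<subseteq> coinv v" for v
  proof (rule coinv_inject)
    show "mset v = mset (max_class w)"
      using that assms by (simp add: mem_metasylv_class metasylv_equiv_mset mset_max_class)
    show "coinv v = coinv (max_class w)"
      using that le by blast
  qed
  with mem show "max_class w \<in> metasylv_class m n w \<and>
      (\<forall>v\<in>metasylv_class m n w. coinv (max_class w) \<subseteq> coinv v \<longrightarrow> v = max_class w)"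
    by blast
  show "v = max_class w" if "v \<in> metasylv_class m n w \<and>
      (\<forall>t\<in>metasylv_class m n w. coinv v \<subseteq> coinv t \<longrightarrow> t = v)" for v
    using that le mem by metis
qed

text \<open>The join is a chosen least upper bound, so its value is known only after uniqueness is
  shown along with existence.\<close>

lemma join_eqI:
  assumes "least L j (Upper L {x, y})"
    and "\<And>j'. least L j' (Upper L {x, y}) \<Longrightarrow> j' = j"
  shows "x \<squnion>\<^bsub>L\<^esub> y = j"
  unfolding join_def sup_def using assms by (metis someI_ex)

theorem proposition3p8:
  fixes m n :: nat and \<sigma> \<mu> :: "nat list"
  assumes "m \<ge> 1" and "n \<ge> 1"
    and "\<sigma> \<in> mperms m n" and "\<mu> \<in> mperms m n"
  shows "metasylv_class m n (\<sigma> \<squnion>\<^bsub>mperm_lattice m n\<^esub> \<mu>) =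
         metasylv_class m n \<sigma> \<squnion>\<^bsub>metasylv_lattice m n\<^esub> metasylv_class m n \<mu>"
proof -
  let ?P = "mperm_lattice m n" and ?L = "metasylv_lattice m n" and ?C = "metasylv_class m n"
  note mp = assms(3,4)
  have "Upper ?P {\<sigma>, \<mu>} = {y \<in> mperms m n. coinv \<sigma> \<subseteq> coinv y \<and> coinv \<mu> \<subseteq> coinv y}"
    using mp unfolding Upper_def mperm_lattice_def by (simp, blast)
  then have least_P: "least ?P x (Upper ?P {\<sigma>, \<mu>}) \<longleftrightarrow>
      x \<in> mperms m n \<and> coinv \<sigma> \<subseteq> coinv x \<and> coinv \<mu> \<subseteq> coinv x \<and>
      (\<forall>y\<in>mperms m n. coinv \<sigma> \<subseteq> coinv y \<and> coinv \<mu> \<subseteq> coinv y \<longrightarrow> coinv x \<subseteq> coinv y)" for x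
    by (auto simp: least_def mperm_lattice_def)
  obtain \<rho> where \<rho>: "mset \<rho> = mset \<mu>" "coinv \<rho> = (coinv \<sigma> \<union> coinv \<mu>)\<^sup>+"
    using coinv_join_exists[OF mperms_mset_eq[OF mp]] by blast
  have \<rho>_mp: "\<rho> \<in> mperms m n"
    using \<rho>(1) mp mperms_mset_cong by blast
  have \<rho>_ge: "coinv \<sigma> \<subseteq> coinv \<rho>" "coinv \<mu> \<subseteq> coinv \<rho>"
    unfolding \<rho>(2) by auto
  \<comment> \<open>\<open>coinv y\<close> is transitive, so it contains the transitive closure of
    any set it contains.\<close>
  have \<rho>_le: "coinv \<rho> \<subseteq> coinv y" if "coinv \<sigma> \<subseteq> coinv y" "coinv \<mu> \<subseteq> coinv y" for y
    unfolding \<rho>(2) using that by (metis Un_least trancl_id trancl_mono_subset trans_coinv)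
  have "\<sigma> \<squnion>\<^bsub>?P\<^esub> \<mu> = \<rho>"
  proof (rule join_eqI)
    show "least ?P \<rho> (Upper ?P {\<sigma>, \<mu>})"
      using \<rho>_mp \<rho>_ge \<rho>_le by (simp add: least_P)
    show "x = \<rho>" if "least ?P x (Upper ?P {\<sigma>, \<mu>})" for x
      using that \<rho>_mp \<rho>_ge \<rho>_le[of x] unfolding least_P
      by (intro coinv_inject mperms_mset_eq) auto
  qed
  moreover have "?C \<sigma> \<squnion>\<^bsub>?L\<^esub> ?C \<mu> = ?C \<rho>"
  proof (rule join_eqI)
    have carrier: "carrier ?L = ?C ` mperms m n"
      by (auto simp: metasylv_lattice_def metasylv_class_def quotient_def)
    \<comment> \<open>Classes are compared through their maxima, but the maximum on the left may be
      replaced by any member, by the closure property.\<close>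
    have le: "?C v \<sqsubseteq>\<^bsub>?L\<^esub> ?C w \<longleftrightarrow> coinv v \<subseteq> coinv (max_class w)"
      if "v \<in> mperms m n" "w \<in> mperms m n" for v w
      using that max_class_le_iff[of "max_class w" v]
      by (simp add: metasylv_lattice_def mperm_lattice_def class_max_metasylv_class
          mset_max_class avoids_aba_max_class mperms_mset_eq[OF that(2,1)])
    \<comment> \<open>This is where the joins meet: \<open>max_class w\<close> is itself a word, so
      it lies above \<open>\<sigma>\<close> and \<open>\<mu>\<close> exactly when it lies above
      their join \<open>\<rho>\<close>.\<close>
    have Upper: "?C w \<in> Upper ?L {?C \<sigma>, ?C \<mu>} \<longleftrightarrow> coinv \<rho> \<subseteq> coinv (max_class w)"
      if "w \<in> mperms m n" for w
      using that mp carrier le[of \<sigma> w] le[of \<mu> w] \<rho>_ge \<rho>_le[of "max_class w"]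
      by (auto simp: Upper_def)
    have Upper_sub: "Upper ?L {?C \<sigma>, ?C \<mu>} \<subseteq> ?C ` mperms m n"
      unfolding carrier[symmetric] by (simp add: Upper_def)
    have C\<rho>: "?C \<rho> \<in> Upper ?L {?C \<sigma>, ?C \<mu>}"
      using Upper[OF \<rho>_mp] coinv_le_max_class by simp
    show "least ?L (?C \<rho>) (Upper ?L {?C \<sigma>, ?C \<mu>})"
      unfolding least_def
    proof (intro conjI ballI)
      show "Upper ?L {?C \<sigma>, ?C \<mu>} \<subseteq> carrier ?L"
        using Upper_sub carrier by simp
      show "?C \<rho> \<sqsubseteq>\<^bsub>?L\<^esub> D" if "D \<in> Upper ?L {?C \<sigma>, ?C \<mu>}" for D
      proof -
        obtain w where "w \<in> mperms m n" "D = ?C w"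
          using \<open>D \<in> _\<close> Upper_sub by blast
        then show ?thesis
          using \<open>D \<in> _\<close> Upper[of w] le[OF \<rho>_mp, of w] by simp
      qed
    qed (fact C\<rho>)
    \<comment> \<open>Two least upper bounds lie below each other, so their maximal elements have
      equal co-inversions and the classes agree.\<close>
    show "D = ?C \<rho>" if "least ?L D (Upper ?L {?C \<sigma>, ?C \<mu>})" for D
    proof -
      have D: "D \<in> Upper ?L {?C \<sigma>, ?C \<mu>}" "D \<sqsubseteq>\<^bsub>?L\<^esub> ?C \<rho>"
        using that C\<rho> by (auto simp: least_def)
      then obtain w where w: "w \<in> mperms m n" "D = ?C w"
        using Upper_sub by blast
      have "mset (max_class w) = mset (max_class \<rho>)"
        by (simp add: mset_max_class mperms_mset_eq[OF w(1) \<rho>_mp])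
      moreover have "coinv (max_class w) \<subseteq> coinv (max_class \<rho>)"
        using D(2) le[OF w(1) \<rho>_mp] w(2) max_class_le_iff[of "max_class \<rho>" w]
        by (simp add: mset_max_class avoids_aba_max_class mperms_mset_eq[OF w(1) \<rho>_mp])
      moreover have "coinv (max_class \<rho>) \<subseteq> coinv (max_class w)"
        using D(1) Upper[OF w(1)] w(2) max_class_le_iff[of "max_class w" \<rho>]
        by (simp add: mset_max_class avoids_aba_max_class mperms_mset_eq[OF w(1) \<rho>_mp])
      ultimately show ?thesis
        unfolding w(2) by (intro metasylv_class_eqI w(1) \<rho>_mp coinv_inject equalityI)
    qed
  qed
  ultimately show ?thesis
    by simp
qed

end
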